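(* Let $s_*>0$ and let $V\in\mathcal{D}'(\mathbb{T};\mathbb{C})$ be the random potential defined by $$V(x)=(2\pi)^{-\frac12}\sum_{k\in\mathbb{Z}}X_k\langle k\rangle^{-s_*}e^{ikx},$$ where the $X_k\sim\mathcal{N}(0,1)$, $k\in\mathbb{Z}$, are independent normalized real Gaussian random variables. For $k\in\mathbb{Z}$, let $\omega_k:=k^2+(2\pi)^{\frac12}V_k$. Then, almost surely, the frequencies $\omega=(\omega_k)_{k\in\mathbb{Z}}$ are strongly-non-resonant.
   Context: $\mathbb{T}=\mathbb{R}/2\pi\mathbb{Z}$, $\langle x\rangle=(1+x^2)^{1/2}$, $\mathbb{Z}^*=\mathbb{Z}\setminus\{0\}$. Fourier coefficients: $V_k=(2\pi)^{-1/2}\int_{\mathbb{T}}V(x)e^{-ikx}\,dx$ (so here $V_k=X_k\langle k\rangle^{-s_*}$). Strong non-resonance: given $\mathcal{I}\subset\mathbb{Z}$, a family $\omega\in\mathbb{R}^{\mathcal{I}}$ is strongly-non-resonant if there exist $\alpha,\rho>0$ such that for all $q\ge1$, all $\boldsymbol{m}\in(\mathbb{Z}^* )^q$ with $\boldsymbol{m}_1+\cdots+\boldsymbol{m}_q=0$, and all distinct $\boldsymbol{h}_1,\dots,\boldsymbol{h}_q\in\mathcal{I}$, $$\Big|\sum_{j=1}^q\boldsymbol{m}_j\omega_{\boldsymbol{h}_j}\Big|\ge\rho\big(2\min_{1\le j\le q}\langle\boldsymbol{h}_j\rangle\big)^{-\exp(\alpha|\boldsymbol{m}|_1)},\qquad|\boldsymbol{m}|_1=|\boldsymbol{m}_1|+\cdots+|\boldsymbol{m}_q|.$$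 Here $\mathcal{I}=\mathbb{Z}$. *)

theory Defs
  imports "HOL-Probability.Probability"
begin

definition japanese_bracket :: "real \<Rightarrow> real" where
  "japanese_bracket x = sqrt (1 + x\<^sup>2)"

(* Families in R^I are total functions of which only the values on I matter; the q-tuples m and h
   are functions of which only the values on {1..q} matter. *)
definition strongly_non_resonant :: "int set \<Rightarrow> (int \<Rightarrow> real) \<Rightarrow> bool" where
  "strongly_non_resonant I \<omega> \<longleftrightarrow>
    (\<exists>\<alpha>>0. \<exists>\<rho>>0. \<forall>q\<ge>1. \<forall>(m :: nat \<Rightarrow> int) (h :: nat \<Rightarrow> int).
      (\<forall>j\<in>{1..q}. m j \<noteq> 0) \<and> (\<Sum>j=1..q. m j) = 0 \<and>
      (\<forall>j\<in>{1..q}. h j \<in> I) \<and> inj_on h {1..q} \<longrightarrow>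
      \<bar>\<Sum>j=1..q. real_of_int (m j) * \<omega> (h j)\<bar> \<ge>
        \<rho> * (2 * Min ((\<lambda>j. japanese_bracket (real_of_int (h j))) ` {1..q}))
              powr (- exp (\<alpha> * real_of_int (\<Sum>j=1..q. \<bar>m j\<bar>))))"

(* Functions on the torus R / 2 pi Z are identified with 2 pi-periodic functions on R. *)
definition nth_deriv :: "nat \<Rightarrow> (real \<Rightarrow> complex) \<Rightarrow> real \<Rightarrow> complex" where
  "nth_deriv n \<phi> = ((\<lambda>f x. vector_derivative f (at x)) ^^ n) \<phi>"

definition torus_test_functions :: "(real \<Rightarrow> complex) set" where
  "torus_test_functions =
    {\<phi>. (\<forall>x. \<phi> (x + 2 * pi) = \<phi> x) \<and> (\<forall>n x. nth_deriv n \<phi> differentiable at x)}"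

(* The set D'(T;C). Values of a functional outside the test functions are irrelevant; continuity
   is expressed by the seminorms that define the Frechet topology on the test functions. *)
definition torus_distributions :: "((real \<Rightarrow> complex) \<Rightarrow> complex) set" where
  "torus_distributions =
    {T. (\<forall>\<phi>\<in>torus_test_functions. \<forall>\<psi>\<in>torus_test_functions. \<forall>a b.
           T (\<lambda>x. a * \<phi> x + b * \<psi> x) = a * T \<phi> + b * T \<psi>) \<and>
        (\<exists>C N. \<forall>\<phi>\<in>torus_test_functions.
           norm (T \<phi>) \<le> C * (\<Sum>n\<le>N. SUP x\<in>{0..2*pi}. norm (nth_deriv n \<phi> x)))}"

definition torus_char :: "int \<Rightarrow> real \<Rightarrow> complex" where
  "torus_char k x = exp (\<i> * of_int k * of_real x)"

(* The distribution given by the series of the c k e^{ikx}, acting on test functions term by term. *)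
definition trig_series :: "(int \<Rightarrow> complex) \<Rightarrow> (real \<Rightarrow> complex) \<Rightarrow> complex" where
  "trig_series c \<phi> = (\<Sum>\<^sub>\<infinity>k. c k * integral {0..2*pi} (\<lambda>x. torus_char k x * \<phi> x))"

(* For a distribution T, the integral of T(x) e^{-ikx} over the torus is the pairing of T
   with the test function e^{-ikx}. *)
definition fourier_coeff :: "((real \<Rightarrow> complex) \<Rightarrow> complex) \<Rightarrow> int \<Rightarrow> complex" where
  "fourier_coeff T k = complex_of_real ((2 * pi) powr (- 1/2)) * T (torus_char (- k))"

definition random_potential ::
    "real \<Rightarrow> (int \<Rightarrow> 'w \<Rightarrow> real) \<Rightarrow> 'w \<Rightarrow> (real \<Rightarrow> complex) \<Rightarrow> complex" where
  "random_potential s X w =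
    trig_series (\<lambda>k. complex_of_real
      ((2 * pi) powr (- 1/2) * (X k w * japanese_bracket (real_of_int k) powr (- s))))"

lemma integral_torus_char:
  "integral {0..2*pi} (torus_char k) = (if k = 0 then complex_of_real (2 * pi) else 0)"
proof (cases "k = 0")
  case True
  then show ?thesis by (simp add: torus_char_def[abs_def] scaleR_conv_of_real)
next
  case False
  have d: "((\<lambda>x. torus_char k x / (\<i> * of_int k)) has_vector_derivative torus_char k x) (at x within A)"
    for x A
  proof -
    have "((\<lambda>z. exp (\<i> * of_int k * z) / (\<i> * of_int k)) has_field_derivative exp (\<i> * of_int k * of_real x))
        (at (of_real x))"
      using False by (auto intro!: derivative_eq_intros)
    then show ?thesis
      unfolding torus_char_def
      by (rule has_vector_derivative_real_field)
  qed
  have "(torus_char k has_integral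
      torus_char k (2*pi) / (\<i> * of_int k) - torus_char k 0 / (\<i> * of_int k)) {0..2*pi}"
    by (rule fundamental_theorem_of_calculus) (use d in auto)
  moreover have "torus_char k (2*pi) = 1"
    unfolding torus_char_def
    by (subst exp_eq_1) (auto simp: intro!: exI[of _ k])
  moreover have "torus_char k 0 = 1"
    by (simp add: torus_char_def)
  ultimately show ?thesis
    using False by (simp add: integral_unique)
qed

lemma torus_char_mult: "torus_char k x * torus_char l x = torus_char (k + l) x"
  by (simp add: torus_char_def exp_add[symmetric] algebra_simps)

lemma trig_series_torus_char:
  fixes c :: "int \<Rightarrow> complex"
  shows "trig_series c (torus_char (- k)) = 2 * pi * c k"
proof -
  have "trig_series c (torus_char (- k)) = (\<Sum>\<^sub>\<infinity>l. if l = k then 2 * pi * c k else 0)"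
    unfolding trig_series_def torus_char_mult
    by (intro infsum_cong) (simp add: integral_torus_char)
  also have "\<dots> = (\<Sum>\<^sub>\<infinity>l\<in>{k}. 2 * pi * c k)"
    by (rule infsum_cong_neutral) auto
  finally show ?thesis by simp
qed

(* In particular, the Fourier coefficients of the random potential are real. *)
lemma fourier_coeff_random_potential:
  "fourier_coeff (random_potential s X w) k =
    complex_of_real (X k w * japanese_bracket (real_of_int k) powr (- s))"
proof -
  define a where "a = (2 * pi) powr (- 1/2)"
  define y where "y = X k w * japanese_bracket (real_of_int k) powr (- s)"
  have a: "a * (2 * pi * (a * y)) = y"
  proof -
    have "a * a * (2 * pi) = 1"
      by (simp add: a_def powr_add[symmetric] powr_minus field_simps)
    then show ?thesis by (metis mult.assoc mult.commute mult_1)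
  qed
  have "fourier_coeff (random_potential s X w) k = complex_of_real (a * (2 * pi * (a * y)))"
    unfolding fourier_coeff_def random_potential_def trig_series_torus_char
    by (simp add: a_def y_def)
  then show ?thesis
    unfolding a by (simp add: y_def)
qed

(* The series that defines the random potential converges almost surely in D'(T;C). *)

lemma nth_deriv_has_vector_derivative:
  assumes "\<phi> \<in> torus_test_functions"
  shows "(nth_deriv n \<phi> has_vector_derivative nth_deriv (Suc n) \<phi> x) (at x within A)"
  using assms unfolding torus_test_functions_def
  by (auto simp: nth_deriv_def vector_derivative_works[symmetric]
      intro: has_vector_derivative_at_within)

lemma continuous_on_nth_deriv:
  assumes "\<phi> \<in> torus_test_functions"
  shows "continuous_on A (nth_deriv n \<phi>)"
  by (rule continuous_on_vector_derivative) (rule nth_deriv_has_vector_derivative[OF assms])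

lemma nth_deriv_periodic:
  assumes \<phi>: "\<phi> \<in> torus_test_functions"
  shows "nth_deriv n \<phi> (x + 2 * pi) = nth_deriv n \<phi> x"
proof (induction n arbitrary: x)
  case 0
  then show ?case using \<phi> by (simp add: torus_test_functions_def nth_deriv_def)
next
  case (Suc n)
  have "((nth_deriv n \<phi> \<circ> (\<lambda>x. x + 2 * pi)) has_vector_derivative
      1 *\<^sub>R nth_deriv (Suc n) \<phi> (x + 2 * pi)) (at x)"
    by (rule vector_diff_chain_at)
      (auto intro!: derivative_eq_intros nth_deriv_has_vector_derivative[OF \<phi>])
  moreover have "nth_deriv n \<phi> \<circ> (\<lambda>x. x + 2 * pi) = nth_deriv n \<phi>"
    using Suc.IH by auto
  ultimately show ?case
    using vector_derivative_unique_at[OF _ nth_deriv_has_vector_derivative[OF \<phi>]] by auto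
qed

lemma torus_char_has_vector_derivative:
  "(torus_char k has_vector_derivative \<i> * of_int k * torus_char k x) (at x within A)"
proof -
  have "((\<lambda>z. exp (\<i> * of_int k * z)) has_field_derivative
      \<i> * of_int k * exp (\<i> * of_int k * of_real x)) (at (of_real x))"
    by (auto intro!: derivative_eq_intros)
  then show ?thesis
    unfolding torus_char_def[abs_def]
    by (rule has_vector_derivative_real_field)
qed

lemma continuous_on_torus_char: "continuous_on A (torus_char k)"
  by (rule continuous_on_vector_derivative) (rule torus_char_has_vector_derivative)

lemma torus_char_0: "torus_char k 0 = 1"
  by (simp add: torus_char_def)

lemma torus_char_2pi: "torus_char k (2 * pi) = 1"
  unfolding torus_char_def
  by (subst exp_eq_1) (auto simp: intro!: exI[of _ k])

lemma norm_torus_char: "norm (torus_char k x) = 1"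
  by (simp add: torus_char_def)

lemma integral_torus_char_nth_deriv_Suc:
  assumes \<phi>: "\<phi> \<in> torus_test_functions"
  shows "integral {0..2*pi} (\<lambda>x. torus_char k x * nth_deriv (Suc n) \<phi> x) =
    - (\<i> * of_int k * integral {0..2*pi} (\<lambda>x. torus_char k x * nth_deriv n \<phi> x))"
proof -
  have int: "(\<lambda>x. torus_char k x * nth_deriv n \<phi> x) integrable_on {0..2*pi}" for n
    by (intro integrable_continuous_real continuous_intros continuous_on_torus_char
        continuous_on_nth_deriv[OF \<phi>])
  have "((\<lambda>x. torus_char k x * nth_deriv (Suc n) \<phi> x +
          \<i> * of_int k * torus_char k x * nth_deriv n \<phi> x) has_integral
      torus_char k (2*pi) * nth_deriv n \<phi> (2*pi) - torus_char k 0 * nth_deriv n \<phi> 0) {0..2*pi}"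
    by (rule fundamental_theorem_of_calculus)
      (auto intro!: has_vector_derivative_mult torus_char_has_vector_derivative
        nth_deriv_has_vector_derivative[OF \<phi>])
  then have "((\<lambda>x. torus_char k x * nth_deriv (Suc n) \<phi> x +
          \<i> * of_int k * (torus_char k x * nth_deriv n \<phi> x)) has_integral 0) {0..2*pi}"
    using nth_deriv_periodic[OF \<phi>, of n 0] by (simp add: torus_char_0 torus_char_2pi mult.assoc)
  then have "integral {0..2*pi} (\<lambda>x. torus_char k x * nth_deriv (Suc n) \<phi> x +
          \<i> * of_int k * (torus_char k x * nth_deriv n \<phi> x)) = 0"
    by (rule integral_unique)
  moreover have "integral {0..2*pi} (\<lambda>x. torus_char k x * nth_deriv (Suc n) \<phi> x +
          \<i> * of_int k * (torus_char k x * nth_deriv n \<phi> x)) =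
      integral {0..2*pi} (\<lambda>x. torus_char k x * nth_deriv (Suc n) \<phi> x) +
      integral {0..2*pi} (\<lambda>x. \<i> * of_int k * (torus_char k x * nth_deriv n \<phi> x))"
    by (intro integral_add int integrable_on_mult_right)
  ultimately show ?thesis
    by (simp add: eq_neg_iff_add_eq_0)
qed

lemma nth_deriv_le_SUP:
  assumes "\<phi> \<in> torus_test_functions" "x \<in> {0..2*pi}"
  shows "norm (nth_deriv n \<phi> x) \<le> (SUP x\<in>{0..2*pi}. norm (nth_deriv n \<phi> x))"
proof (rule cSUP_upper[OF assms(2)])
  have "compact ((\<lambda>x. norm (nth_deriv n \<phi> x)) ` {0..2*pi})"
    by (intro compact_continuous_image continuous_intros continuous_on_nth_deriv[OF assms(1)]) auto
  then show "bdd_above ((\<lambda>x. norm (nth_deriv n \<phi> x)) ` {0..2*pi})"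
    by (simp add: bounded_imp_bdd_above compact_imp_bounded)
qed

lemma norm_integral_torus_char_nth_deriv:
  assumes \<phi>: "\<phi> \<in> torus_test_functions"
  shows "norm (integral {0..2*pi} (\<lambda>x. torus_char k x * nth_deriv n \<phi> x)) \<le>
    2 * pi * (SUP x\<in>{0..2*pi}. norm (nth_deriv n \<phi> x))"
proof -
  have "norm (integral {0..2*pi} (\<lambda>x. torus_char k x * nth_deriv n \<phi> x)) \<le>
      (SUP x\<in>{0..2*pi}. norm (nth_deriv n \<phi> x)) * (2 * pi - 0)"
    by (rule integral_bound)
      (auto intro!: continuous_intros continuous_on_torus_char continuous_on_nth_deriv[OF \<phi>]
        nth_deriv_le_SUP[OF \<phi>] simp: norm_mult norm_torus_char)
  then show ?thesis by (simp add: mult.commute)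
qed

lemma summable_on_int_inverse_squares:
  "(\<lambda>k::int. 4 / (1 + (real_of_int k)\<^sup>2)) summable_on UNIV"
proof -
  let ?f = "\<lambda>k::int. 4 / (1 + (real_of_int k)\<^sup>2)"
  have "summable (\<lambda>n. 4 / (1 + (real n)\<^sup>2))"
  proof (rule summable_comparison_test')
    show "summable (\<lambda>n. 4 * (1 / (real n)\<^sup>2))"
      using inverse_power_summable[of 2, where 'a = real]
      by (intro summable_mult) (simp add: inverse_eq_divide)
    show "norm (4 / (1 + (real n)\<^sup>2)) \<le> 4 * (1 / (real n)\<^sup>2)" if "n \<ge> 1" for n
    proof -
      have "4 / (1 + (real n)\<^sup>2) \<le> 4 / (real n)\<^sup>2"
        using that by (intro divide_left_mono mult_pos_pos) (auto simp: add_pos_nonneg)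
      then show ?thesis by simp
    qed
  qed
  then have sn: "(\<lambda>n::nat. 4 / (1 + (real n)\<^sup>2)) summable_on UNIV"
    by (subst summable_on_UNIV_nonneg_real_iff) (auto simp: add_nonneg_nonneg)
  have "?f summable_on range int"
    by (subst summable_on_reindex) (use sn in \<open>auto simp: o_def inj_on_def\<close>)
  moreover have "?f summable_on range (\<lambda>n. - int n)"
    by (subst summable_on_reindex) (use sn in \<open>auto simp: o_def inj_on_def\<close>)
  ultimately have "?f summable_on (range int \<union> range (\<lambda>n. - int n))"
    by (rule summable_on_union)
  moreover have "range int \<union> range (\<lambda>n. - int n) = UNIV"
  proof (rule UNIV_eq_I[symmetric])
    show "k \<in> range int \<union> range (\<lambda>n. - int n)" for k
      by (cases k rule: int_cases2) auto
  qed
  ultimately show ?thesis by simp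
qed

lemma norm_trig_series_term:
  fixes c :: "int \<Rightarrow> complex"
  assumes c: "\<And>k. norm (c k) \<le> C * japanese_bracket (real_of_int k)"
    and \<phi>: "\<phi> \<in> torus_test_functions"
  shows "norm (c k * integral {0..2*pi} (\<lambda>x. torus_char k x * \<phi> x)) \<le>
    C * (2 * pi) * (\<Sum>n\<le>3. SUP x\<in>{0..2*pi}. norm (nth_deriv n \<phi> x)) * (4 / (1 + (real_of_int k)\<^sup>2))"
proof -
  define I where "I n = integral {0..2*pi} (\<lambda>x. torus_char k x * nth_deriv n \<phi> x)" for n
  define S where "S n = (SUP x\<in>{0..2*pi}. norm (nth_deriv n \<phi> x))" for n
  have S0: "S n \<ge> 0" for n
    using order_trans[OF norm_ge_zero nth_deriv_le_SUP[OF \<phi>, of 0 n]] unfolding S_def by simp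
  have SS: "S m \<le> (\<Sum>n\<le>3. S n)" if "m \<le> 3" for m
    using that S0 by (intro member_le_sum) auto
  have IS: "norm (I n) \<le> 2 * pi * S n" for n
    unfolding I_def S_def by (rule norm_integral_torus_char_nth_deriv[OF \<phi>])
  have I0: "integral {0..2*pi} (\<lambda>x. torus_char k x * \<phi> x) = I 0"
    by (simp add: I_def nth_deriv_def)
  have C0: "C \<ge> 0"
    using order_trans[OF norm_ge_zero c[of 0]] by (simp add: japanese_bracket_def)
  have rec: "norm (I (Suc n)) = \<bar>real_of_int k\<bar> * norm (I n)" for n
    unfolding I_def integral_torus_char_nth_deriv_Suc[OF \<phi>] by (simp add: norm_mult)
  have "japanese_bracket (real_of_int k) * norm (I 0) \<le>
      2 * pi * (\<Sum>n\<le>3. S n) * (4 / (1 + (real_of_int k)\<^sup>2))"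
  proof (cases "k = 0")
    case True
    have "norm (I 0) \<le> 2 * pi * (\<Sum>n\<le>3. S n)"
      using IS[of 0] SS[of 0] by (smt (verit) mult_left_mono pi_gt_zero le0)
    then show ?thesis
      using True mult_nonneg_nonneg[OF less_imp_le[OF pi_gt_zero] sum_nonneg[of "{..3}" S]] S0
      by (simp add: japanese_bracket_def)
  next
    case False
    define a where "a = \<bar>real_of_int k\<bar>"
    have a: "a \<ge> 1" using False unfolding a_def by linarith
    have a2: "(real_of_int k)\<^sup>2 = a\<^sup>2" by (simp add: a_def)
    have a1: "1 \<le> a\<^sup>2" using a by simp
    have j: "japanese_bracket (real_of_int k) \<le> 2 * a"
      unfolding japanese_bracket_def a2
    proof (rule real_le_lsqrt)
      show "1 + a\<^sup>2 \<le> (2 * a)\<^sup>2"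
        using a1 unfolding power_mult_distrib by (simp add: power2_eq_square[of 2])
    qed (use a in auto)
    have "a ^ 3 * norm (I 0) = norm (I 3)"
      using rec by (simp add: numeral_3_eq_3 a_def)
    also have "\<dots> \<le> 2 * pi * (\<Sum>n\<le>3. S n)"
      using IS[of 3] SS[of 3] by (smt (verit) mult_left_mono pi_gt_zero le_refl)
    finally have b: "a ^ 3 * norm (I 0) \<le> 2 * pi * (\<Sum>n\<le>3. S n)" .
    have "japanese_bracket (real_of_int k) * norm (I 0) \<le> 2 * a * norm (I 0)"
      using j by (intro mult_right_mono) auto
    also have "\<dots> = (a ^ 3 * norm (I 0)) * (2 / a\<^sup>2)"
      using a by (simp add: power2_eq_square power3_eq_cube)
    also have "\<dots> \<le> (2 * pi * (\<Sum>n\<le>3. S n)) * (2 / a\<^sup>2)"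
      using b by (intro mult_right_mono) auto
    also have "\<dots> \<le> (2 * pi * (\<Sum>n\<le>3. S n)) * (4 / (1 + a\<^sup>2))"
    proof (rule mult_left_mono)
      show "2 / a\<^sup>2 \<le> 4 / (1 + a\<^sup>2)"
      proof -
        have "4 / (2 * a\<^sup>2) \<le> 4 / (1 + a\<^sup>2)"
          using a1 by (intro divide_left_mono mult_pos_pos) linarith+
        then show ?thesis by simp
      qed
      show "0 \<le> 2 * pi * (\<Sum>n\<le>3. S n)"
        using S0 by (intro mult_nonneg_nonneg sum_nonneg) auto
    qed
    finally show ?thesis by (simp only: a2)
  qed
  then have "C * (japanese_bracket (real_of_int k) * norm (I 0)) \<le>
      C * (2 * pi * (\<Sum>n\<le>3. S n) * (4 / (1 + (real_of_int k)\<^sup>2)))"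
    using C0 by (rule mult_left_mono)
  moreover have "norm (c k * I 0) \<le> C * japanese_bracket (real_of_int k) * norm (I 0)"
    unfolding norm_mult using c by (rule mult_right_mono) auto
  ultimately show ?thesis
    unfolding I0 S_def[symmetric] by (simp only: mult.assoc)
qed

lemma trig_series_abs_summable:
  fixes c :: "int \<Rightarrow> complex"
  assumes "\<And>k. norm (c k) \<le> C * japanese_bracket (real_of_int k)"
    and "\<phi> \<in> torus_test_functions"
  shows "(\<lambda>k. norm (c k * integral {0..2*pi} (\<lambda>x. torus_char k x * \<phi> x))) summable_on UNIV"
proof (rule summable_on_comparison_test)
  show "(\<lambda>k. C * (2 * pi) * (\<Sum>n\<le>3. SUP x\<in>{0..2*pi}. norm (nth_deriv n \<phi> x)) *
      (4 / (1 + (real_of_int k)\<^sup>2))) summable_on UNIV"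
    by (intro summable_on_cmult_right summable_on_int_inverse_squares)
qed (use norm_trig_series_term[OF assms] in auto)

lemma trig_series_distribution:
  fixes c :: "int \<Rightarrow> complex"
  assumes c: "\<And>k. norm (c k) \<le> C * japanese_bracket (real_of_int k)"
  shows "trig_series c \<in> torus_distributions"
proof -
  note sm = trig_series_abs_summable[OF c]
  define J where "J k \<phi> = integral {0..2*pi} (\<lambda>x. torus_char k x * \<phi> x)" for k \<phi>
  have lin: "trig_series c (\<lambda>x. a * \<phi> x + b * \<psi> x) = a * trig_series c \<phi> + b * trig_series c \<psi>"
    if \<phi>: "\<phi> \<in> torus_test_functions" and \<psi>: "\<psi> \<in> torus_test_functions" for \<phi> \<psi> a b
  proof -
    have int: "(\<lambda>x. torus_char k x * f x) integrable_on {0..2*pi}"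
      if "f \<in> torus_test_functions" for f k
      using continuous_on_nth_deriv[OF that, of _ 0]
      by (intro integrable_continuous_real continuous_intros continuous_on_torus_char)
        (simp add: nth_deriv_def)
    have J: "J k (\<lambda>x. a * \<phi> x + b * \<psi> x) = a * J k \<phi> + b * J k \<psi>" for k
    proof -
      have "J k (\<lambda>x. a * \<phi> x + b * \<psi> x) =
          integral {0..2*pi} (\<lambda>x. a * (torus_char k x * \<phi> x) + b * (torus_char k x * \<psi> x))"
        unfolding J_def by (simp add: algebra_simps)
      also have "\<dots> = a * J k \<phi> + b * J k \<psi>"
        unfolding J_def
        by (subst integral_add) (auto intro!: integrable_on_mult_right int \<phi> \<psi>)
      finally show ?thesis .
    qed
    have s: "(\<lambda>k. c k * J k f) summable_on UNIV" if "f \<in> torus_test_functions" for f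
      using abs_summable_summable[OF sm[OF that]] unfolding J_def .
    have "trig_series c (\<lambda>x. a * \<phi> x + b * \<psi> x) =
        (\<Sum>\<^sub>\<infinity>k. a * (c k * J k \<phi>) + b * (c k * J k \<psi>))"
      unfolding trig_series_def J_def[symmetric] J by (simp add: algebra_simps)
    also have "\<dots> = a * trig_series c \<phi> + b * trig_series c \<psi>"
      unfolding trig_series_def J_def[symmetric]
      by (subst infsum_add) (auto intro!: summable_on_cmult_right s \<phi> \<psi> simp: infsum_cmult_right')
    finally show ?thesis .
  qed
  have "norm (trig_series c \<phi>) \<le>
      (C * (2 * pi) * (\<Sum>\<^sub>\<infinity>k::int. 4 / (1 + (real_of_int k)\<^sup>2))) *
      (\<Sum>n\<le>3. SUP x\<in>{0..2*pi}. norm (nth_deriv n \<phi> x))" (is "_ \<le> ?D * ?S")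
    if \<phi>: "\<phi> \<in> torus_test_functions" for \<phi>
  proof -
    have "norm (trig_series c \<phi>) \<le> (\<Sum>\<^sub>\<infinity>k. norm (c k * J k \<phi>))"
      unfolding trig_series_def J_def by (rule norm_infsum_bound[OF sm[OF \<phi>]])
    also have "\<dots> \<le> (\<Sum>\<^sub>\<infinity>k::int. C * (2 * pi) * ?S * (4 / (1 + (real_of_int k)\<^sup>2)))"
      using sm[OF \<phi>] norm_trig_series_term[OF c \<phi>] unfolding J_def
      by (intro infsum_mono summable_on_cmult_right summable_on_int_inverse_squares) auto
    also have "\<dots> = ?D * ?S"
      by (subst infsum_cmult_right') simp
    finally show ?thesis .
  qed
  with lin show ?thesis
    unfolding torus_distributions_def by blast
qed

lemma std_normal_AE_linear_growth:
  fixes Y :: "nat \<Rightarrow> 'w \<Rightarrow> real"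
  assumes "prob_space M" and Y: "\<And>n. distributed M lborel (Y n) std_normal_density"
  shows "AE w in M. \<exists>C. \<forall>n. \<bar>Y n w\<bar> \<le> C * (1 + real n)"
proof -
  interpret prob_space M by fact
  have [measurable]: "Y n \<in> borel_measurable M" for n
    using distributed_measurable[OF Y] by simp
  have "integrable lborel (\<lambda>x. std_normal_density x * x ^ 2)"
    by (rule integrable_std_normal_moment)
  then have int: "integrable M (\<lambda>w. (Y n w)\<^sup>2)" for n
    by (subst distributed_integrable[OF Y, symmetric]) auto
  have mean: "expectation (Y n) = 0" for n
    by (rule standard_normal_distributed_expectation[OF Y])
  have var: "variance (Y n) = 1" for n
    by (rule standard_normal_distributed_variance[OF Y])
  define A where "A n = {w \<in> space M. \<bar>Y n w\<bar> \<ge> 1 + real n}" for n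
  have A[measurable]: "A n \<in> sets M" for n
    unfolding A_def by measurable
  have PA: "prob (A n) \<le> 1 / (1 + real n)\<^sup>2" for n
    using Chebyshev_inequality[of "Y n" "1 + real n"] int mean[of n] var[of n]
    by (simp add: A_def)
  have "summable (\<lambda>n. prob (A n))"
  proof (rule summable_comparison_test')
    show "summable (\<lambda>n. 1 / (1 + real n)\<^sup>2)"
      using summable_ignore_initial_segment[OF inverse_power_summable[of 2, where 'a = real], of 1]
      by (simp add: inverse_eq_divide add.commute)
    show "norm (prob (A n)) \<le> 1 / (1 + real n)\<^sup>2" if "n \<ge> 0" for n
      using PA by simp
  qed
  then have "AE w in M. eventually (\<lambda>n. w \<in> space M - A n) sequentially"
    by (intro borel_cantelli_AE1) (auto simp: emeasure_eq_measure)
  then show ?thesis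
  proof eventually_elim
    case (elim w)
    then obtain N where N: "\<And>n. n \<ge> N \<Longrightarrow> w \<in> space M - A n"
      by (auto simp: eventually_sequentially)
    have "\<bar>Y n w\<bar> \<le> (1 + (\<Sum>i<N. \<bar>Y i w\<bar>)) * (1 + real n)" for n
    proof (cases "n < N")
      case True
      have "\<bar>Y n w\<bar> \<le> (\<Sum>i<N. \<bar>Y i w\<bar>)"
        using True by (intro member_le_sum) auto
      also have "\<dots> \<le> 1 + (\<Sum>i<N. \<bar>Y i w\<bar>)" by simp
      also have "\<dots> \<le> (1 + (\<Sum>i<N. \<bar>Y i w\<bar>)) * (1 + real n)"
        using mult_left_mono[of 1 "1 + real n" "1 + (\<Sum>i<N. \<bar>Y i w\<bar>)"]
        by (simp add: sum_nonneg)
      finally show ?thesis .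
    next
      case False
      then have "\<bar>Y n w\<bar> \<le> 1 * (1 + real n)"
        using N[of n] by (auto simp: A_def)
      also have "\<dots> \<le> (1 + (\<Sum>i<N. \<bar>Y i w\<bar>)) * (1 + real n)"
        by (intro mult_right_mono) (auto simp: sum_nonneg)
      finally show ?thesis .
    qed
    then show ?case by blast
  qed
qed

lemma AE_random_potential_distribution:
  fixes X :: "int \<Rightarrow> 'w \<Rightarrow> real"
  assumes "prob_space M" and "s > 0"
    and X: "\<And>k. distributed M lborel (X k) std_normal_density"
  shows "AE w in M. random_potential s X w \<in> torus_distributions"
    and "AE w in M. \<forall>\<phi>\<in>torus_test_functions.
      (\<lambda>k. norm (complex_of_real
        ((2 * pi) powr (- 1/2) * (X k w * japanese_bracket (real_of_int k) powr (- s))) *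
        integral {0..2*pi} (\<lambda>x. torus_char k x * \<phi> x))) summable_on UNIV"
proof -
  define c where "c w k = complex_of_real
    ((2 * pi) powr (- 1/2) * (X k w * japanese_bracket (real_of_int k) powr (- s)))" for w k
  have "AE w in M. \<exists>C. \<forall>n. \<bar>X (int n) w\<bar> \<le> C * (1 + real n)"
    by (rule std_normal_AE_linear_growth[OF assms(1) X])
  moreover have "AE w in M. \<exists>C. \<forall>n. \<bar>X (- int n) w\<bar> \<le> C * (1 + real n)"
    by (rule std_normal_AE_linear_growth[OF assms(1) X])
  ultimately have "AE w in M. \<exists>C. \<forall>k. norm (c w k) \<le> C * japanese_bracket (real_of_int k)"
  proof eventually_elim
    case (elim w)
    then obtain C1 C2 where C1: "\<And>n. \<bar>X (int n) w\<bar> \<le> C1 * (1 + real n)"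
      and C2: "\<And>n. \<bar>X (- int n) w\<bar> \<le> C2 * (1 + real n)" by blast
    define C where "C = max C1 C2"
    have XC: "\<bar>X k w\<bar> \<le> C * (1 + \<bar>real_of_int k\<bar>)" for k
    proof (cases k rule: int_cases2)
      case (nonneg n)
      have "C1 * (1 + real n) \<le> C * (1 + real n)"
        unfolding C_def by (intro mult_right_mono) auto
      then show ?thesis using order_trans[OF C1] nonneg by simp
    next
      case (nonpos n)
      have "C2 * (1 + real n) \<le> C * (1 + real n)"
        unfolding C_def by (intro mult_right_mono) auto
      then show ?thesis using order_trans[OF C2] nonpos by simp
    qed
    have C0: "C \<ge> 0" using order_trans[OF abs_ge_zero XC[of 0]] by simp
    have "norm (c w k) \<le> (2 * C) * japanese_bracket (real_of_int k)" for k
    proof -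
      let ?j = "japanese_bracket (real_of_int k)"
      have j1: "?j \<ge> 1" by (simp add: japanese_bracket_def)
      have jk: "\<bar>real_of_int k\<bar> \<le> ?j"
        unfolding japanese_bracket_def by (intro real_le_rsqrt) simp
      have p: "(2 * pi) powr (- 1/2) \<le> 1"
        using pi_ge_two powr_mono[of "- 1/2" 0 "2 * pi"] by simp
      have js: "?j powr (- s) \<le> 1"
        using j1 assms(2) powr_mono[of "- s" 0 ?j] by simp
      have "norm (c w k) = (2 * pi) powr (- 1/2) * (\<bar>X k w\<bar> * ?j powr (- s))"
        unfolding c_def norm_of_real by (simp add: abs_mult)
      also have "\<dots> \<le> 1 * (\<bar>X k w\<bar> * 1)"
        using p js by (intro mult_mono) auto
      also have "\<dots> \<le> C * (1 + \<bar>real_of_int k\<bar>)" using XC[of k] by simp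
      also have "\<dots> \<le> C * (2 * ?j)"
        using j1 jk C0 by (intro mult_left_mono) auto
      finally show ?thesis by simp
    qed
    then show ?case by blast
  qed
  note ae = this
  from ae show "AE w in M. random_potential s X w \<in> torus_distributions"
  proof eventually_elim
    case (elim w)
    then show ?case
      using trig_series_distribution[of "c w"] unfolding random_potential_def c_def by blast
  qed
  from ae show "AE w in M. \<forall>\<phi>\<in>torus_test_functions.
      (\<lambda>k. norm (complex_of_real
        ((2 * pi) powr (- 1/2) * (X k w * japanese_bracket (real_of_int k) powr (- s))) *
        integral {0..2*pi} (\<lambda>x. torus_char k x * \<phi> x))) summable_on UNIV"
  proof eventually_elim
    case (elim w)
    then show ?case
      using trig_series_abs_summable[of "c w"] unfolding c_def by blast
  qed
qed

end

theory Submission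
  imports Defs
begin

text \<open>
  Write \<open>\<omega> k = k\<^sup>2 + V k\<close>, where \<open>V k = c * X k * \<langle>k\<rangle> powr (- s)\<close> and \<open>c = sqrt (2 * pi)\<close>. The difficulty is
  that the lower bound required for \<open>\<Sum>j. m j * \<omega> (h j)\<close> involves only the smallest of the
  indices \<open>h j\<close>, whereas a union bound over all the indices yields a bound that
  involves all of them. Two almost sure properties are combined.

  First, \<open>K + \<Sum>j. m j * V (h j)\<close>, with \<open>K\<close> an integer, is Gaussian with variance at least
  \<open>(c * \<langle>h j\<rangle> powr (- s))\<^sup>2\<close> for each \<open>j\<close>, so it lies in \<open>]- \<theta>, \<theta>[\<close> with probability at most
  \<open>2 * \<theta> * \<langle>h j\<rangle> powr s\<close>. For \<open>\<theta> = \<delta> / ((1 + K\<^sup>2) * (\<Prod>j. \<langle>h j\<rangle> ^ t * (1 + (m j)\<^sup>2)))\<close> with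
  \<open>t \<ge> s + 2\<close>, these probabilities have a sum \<open>O(\<delta>)\<close> over all finite families, because
  sums over finite sets of products are dominated by an infinite product. Hence, almost surely,
  some \<open>\<delta> > 0\<close> works for all families at once (\<open>AE_small_divisor_bound\<close>).
  Second, Gaussian moments give \<open>\<bar>V k\<bar> \<le> R * \<langle>k\<rangle> powr (- s / 2)\<close> almost surely, with \<open>R\<close> random
  (\<open>AE_gaussian_growth\<close>).

  The rest is deterministic (\<open>strongly_non_resonant_quadratic_plus\<close>).
  Let \<open>M = \<bar>m\<bar>\<^sub>1\<close> and let \<open>K\<close> be the integer \<open>\<Sum>j. m j * (h j)\<^sup>2\<close>. If \<open>\<bar>K\<bar>\<close> is at least
  \<open>M * R + 1\<close>, the sum is at least \<open>1\<close>. Otherwise \<open>ex_gap_subset\<close> provides a set \<open>S\<close> of positions that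
  contains the position of the smallest index, such that \<open>Q = A * (\<Prod>j\<in>S. \<langle>h j\<rangle> ^ t)\<close>, with \<open>A\<close>
  exponential in \<open>M\<close>, is at most a power of \<open>A * (min \<langle>h j\<rangle>) ^ t\<close> with exponent exponential in
  the number \<open>q \<le> M\<close> of indices, while each index outside \<open>S\<close> has a bracket above \<open>Q ^ r\<close>. The part over
  \<open>S\<close> is bounded from below by the first property, in terms of \<open>Q\<close>; the part outside \<open>S\<close> is
  smaller than this, by the second. The total is at least \<open>1 / Q\<close>, and \<open>Q\<close> is at most
  \<open>(2 * min \<langle>h j\<rangle>) powr exp (\<alpha> * M)\<close>. Since the base is at least \<open>2\<close>, the random constants
  \<open>\<delta>\<close> and \<open>R\<close> are absorbed into \<open>\<alpha>\<close>, so that \<open>\<rho> = 1\<close> suffices.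
\<close>

section \<open>Union bounds for countable families of events\<close>

lemma (in prob_space) prob_UN_le_of_sum_bound:
  fixes p :: "'i \<Rightarrow> real"
  assumes "countable T"
    and E: "\<And>i. i \<in> T \<Longrightarrow> E i \<in> events"
    and p: "\<And>i. i \<in> T \<Longrightarrow> prob (E i) \<le> p i"
    and C: "\<And>A. finite A \<Longrightarrow> A \<subseteq> T \<Longrightarrow> sum p A \<le> C"
  shows "prob (\<Union>i\<in>T. E i) \<le> C"
proof (cases "T = {}")
  case True
  then show ?thesis using C[of "{}"] by simp
next
  case False
  let ?f = "from_nat_into T"
  define D where "D n = (\<Union>i\<in>?f ` {..<n}. E i)" for n
  have f: "?f n \<in> T" for n
    by (rule from_nat_into[OF False])
  have D: "D n \<in> events" for n
    unfolding D_def using E f by auto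
  have le: "prob (D n) \<le> C" for n
  proof -
    have "prob (D n) \<le> (\<Sum>i\<in>?f ` {..<n}. prob (E i))"
      unfolding D_def using E f by (intro finite_measure_subadditive_finite) auto
    also have "\<dots> \<le> sum p (?f ` {..<n})"
      using p f by (intro sum_mono) auto
    also have "\<dots> \<le> C" using f by (intro C) auto
    finally show ?thesis .
  qed
  have "(\<lambda>n. prob (D n)) \<longlonglongrightarrow> prob (\<Union>n. D n)"
    using D by (intro finite_Lim_measure_incseq) (auto simp: D_def incseq_def intro: less_le_trans)
  then have "prob (\<Union>n. D n) \<le> C"
    using le by (intro LIMSEQ_le_const2) auto
  moreover have "(\<Union>n. D n) = (\<Union>i\<in>?f ` UNIV. E i)"
    unfolding D_def by blast
  ultimately show ?thesis
    using range_from_nat_into[OF False \<open>countable T\<close>] by simp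
qed

text \<open>
  A quantitative Borel--Cantelli argument: the union of the events \<open>E i \<delta>\<close> over all \<open>i\<close> has
  probability at most \<open>C * \<delta>\<close>, so the intersection of these unions over \<open>\<delta> = 1 / (n + 1)\<close> is null.
\<close>

lemma (in prob_space) AE_ex_avoid_shrinking_events:
  fixes p :: "'i \<Rightarrow> real" and E :: "'i \<Rightarrow> real \<Rightarrow> 'a set"
  assumes T: "countable T"
    and E: "\<And>i \<delta>. i \<in> T \<Longrightarrow> E i \<delta> \<in> events"
    and p: "\<And>i \<delta>. i \<in> T \<Longrightarrow> 0 < \<delta> \<Longrightarrow> \<delta> \<le> 1 \<Longrightarrow> prob (E i \<delta>) \<le> \<delta> * p i"
    and C: "\<And>A. finite A \<Longrightarrow> A \<subseteq> T \<Longrightarrow> sum p A \<le> C"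
  shows "AE w in M. \<exists>\<delta>. 0 < \<delta> \<and> \<delta> \<le> 1 \<and> (\<forall>i\<in>T. w \<notin> E i \<delta>)"
proof -
  define B where "B n = (\<Union>i\<in>T. E i (1 / real (Suc n)))" for n
  have B: "B n \<in> events" for n
    unfolding B_def using E T by auto
  have le: "prob (B n) \<le> C * (1 / real (Suc n))" for n
    unfolding B_def
  proof (rule prob_UN_le_of_sum_bound[OF T E])
    show "prob (E i (1 / real (Suc n))) \<le> (1 / real (Suc n)) * p i" if "i \<in> T" for i
      using that by (intro p) auto
    show "(\<Sum>i\<in>A. 1 / real (Suc n) * p i) \<le> C * (1 / real (Suc n))"
      if "finite A" "A \<subseteq> T" for A
      using C[OF that] unfolding sum_distrib_left[symmetric]
      by (subst mult.commute) (intro mult_right_mono, auto)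
  qed
  have "prob (\<Inter>n. B n) \<le> C * (1 / real (Suc n))" for n
    using le[of n] finite_measure_mono[of "\<Inter>n. B n" "B n"] B by (auto intro: order_trans)
  moreover have "(\<lambda>n. C * (1 / real (Suc n))) \<longlonglongrightarrow> C * 0"
    using LIMSEQ_inverse_real_of_nat by (intro tendsto_mult tendsto_const) (simp add: inverse_eq_divide)
  ultimately have "prob (\<Inter>n. B n) \<le> 0"
    by (intro LIMSEQ_le_const[where X = "\<lambda>n. C * (1 / real (Suc n))"]) auto
  then have "prob (\<Inter>n. B n) = 0"
    using measure_nonneg[of M "\<Inter>n. B n"] by linarith
  then have null: "(\<Inter>n. B n) \<in> null_sets M"
    using B by (intro null_setsI) (auto simp: emeasure_eq_measure)
  show ?thesis
  proof (rule AE_I'[OF null], safe)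
    fix w n
    assume *: "\<nexists>\<delta>. 0 < \<delta> \<and> \<delta> \<le> 1 \<and> (\<forall>i\<in>T. w \<notin> E i \<delta>)"
    then show "w \<in> B n"
      using *[THEN not_ex[THEN iffD1], THEN spec, of "1 / real (Suc n)"] unfolding B_def by auto
  qed
qed

section \<open>Uniform bounds for finite sums\<close>

lemma sum_int_inverse_squares_bounded:
  obtains C :: real where "C \<ge> 0"
    "\<And>A. finite A \<Longrightarrow> (\<Sum>k\<in>A. 1 / (1 + (real_of_int k)\<^sup>2)) \<le> C"
proof -
  let ?f = "\<lambda>k::int. 4 / (1 + (real_of_int k)\<^sup>2)"
  have "(\<Sum>k\<in>A. 1 / (1 + (real_of_int k)\<^sup>2)) \<le> infsum ?f UNIV" if "finite A" for A
  proof -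
    have "(\<Sum>k\<in>A. 1 / (1 + (real_of_int k)\<^sup>2)) \<le> sum ?f A"
      by (intro sum_mono divide_right_mono) auto
    also have "\<dots> \<le> infsum ?f UNIV"
      using that by (intro finite_sum_le_infsum summable_on_int_inverse_squares) auto
    finally show ?thesis .
  qed
  from this this[of "{}"] show ?thesis by (intro that[of "infsum ?f UNIV"]) auto
qed

text \<open>
  Expanding \<open>(\<Prod>x\<in>A. 1 + u x) \<le> exp (\<Sum>x\<in>A. u x)\<close> gives the sum of the products of \<open>u\<close> over all
  subsets of \<open>A\<close>; for \<open>A\<close> the union of \<open>\<G>\<close>, these include all members of \<open>\<G>\<close>.
\<close>

lemma sum_prod_finite_sets_le_exp:
  fixes u :: "'a \<Rightarrow> real"
  assumes u: "\<And>x. u x \<ge> 0" and C: "\<And>A. finite A \<Longrightarrow> sum u A \<le> C"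
    and \<G>: "finite \<G>" "\<And>G. G \<in> \<G> \<Longrightarrow> finite G"
  shows "(\<Sum>G\<in>\<G>. \<Prod>x\<in>G. u x) \<le> exp C"
proof -
  define A where "A = \<Union>\<G>"
  have A: "finite A" using \<G> by (auto simp: A_def)
  have "(\<Sum>G\<in>\<G>. \<Prod>x\<in>G. u x) \<le> (\<Sum>G\<in>Pow A. \<Prod>x\<in>G. u x)"
    using A u by (intro sum_mono2 prod_nonneg) (auto simp: A_def)
  also have "\<dots> = (\<Prod>x\<in>A. u x + 1)"
    by (simp add: prod_add[OF A])
  also have "\<dots> \<le> (\<Prod>x\<in>A. exp (u x))"
    using u exp_ge_add_one_self by (intro prod_mono) (auto simp: add.commute add_nonneg_nonneg)
  also have "\<dots> = exp (sum u A)"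
    by (simp add: exp_sum[OF A])
  also have "\<dots> \<le> exp C" using C[OF A] by simp
  finally show ?thesis .
qed

section \<open>Gaussian sums in small intervals\<close>

lemma normal_density_le:
  assumes "\<sigma> > 0" shows "normal_density \<mu> \<sigma> x \<le> 1 / \<sigma>"
proof -
  have "sqrt (2 * pi * \<sigma>\<^sup>2) \<ge> sqrt (\<sigma>\<^sup>2)"
    using pi_ge_two by (intro real_sqrt_le_mono) (simp add: mult_le_cancel_right1)
  then have s: "sqrt (2 * pi * \<sigma>\<^sup>2) \<ge> \<sigma>"
    using assms by simp
  have "normal_density \<mu> \<sigma> x \<le> 1 / sqrt (2 * pi * \<sigma>\<^sup>2) * 1"
    unfolding normal_density_def by (intro mult_left_mono) auto
  also have "\<dots> \<le> 1 / \<sigma>"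
    using s assms by (simp add: frac_le)
  finally show ?thesis .
qed

lemma (in prob_space) normal_prob_interval_le:
  assumes Z: "distributed M lborel Z (normal_density \<mu> \<sigma>)" and "\<sigma> > 0" "\<theta> \<ge> 0"
  shows "prob {w \<in> space M. \<bar>K + Z w\<bar> < \<theta>} \<le> 2 * \<theta> / \<sigma>"
proof -
  let ?I = "{- K - \<theta>..- K + \<theta>}"
  have [measurable]: "Z \<in> borel_measurable M"
    using distributed_measurable[OF Z] by simp
  have "{w \<in> space M. \<bar>K + Z w\<bar> < \<theta>} \<subseteq> Z -` ?I \<inter> space M"
    by auto
  then have "emeasure M {w \<in> space M. \<bar>K + Z w\<bar> < \<theta>} \<le> emeasure M (Z -` ?I \<inter> space M)"
    by (intro emeasure_mono) measurable
  also have "\<dots> = (\<integral>\<^sup>+x. ennreal (normal_density \<mu> \<sigma> x) * indicator ?I x \<partial>lborel)"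
    using Z by (intro distributed_emeasure) auto
  also have "\<dots> \<le> (\<integral>\<^sup>+x. ennreal (1 / \<sigma>) * indicator ?I x \<partial>lborel)"
    using normal_density_le[OF \<open>\<sigma> > 0\<close>] by (intro nn_integral_mono mult_right_mono) (auto intro: ennreal_leI)
  also have "\<dots> = ennreal (1 / \<sigma>) * ennreal (2 * \<theta>)"
    using \<open>\<theta> \<ge> 0\<close> by (subst nn_integral_cmult_indicator) auto
  also have "\<dots> = ennreal (2 * \<theta> / \<sigma>)"
    using assms by (subst ennreal_mult[symmetric]) auto
  finally show ?thesis
    using assms by (simp add: emeasure_eq_measure)
qed

lemma (in prob_space) prob_gaussian_sum_small:
  fixes X :: "'i \<Rightarrow> 'a \<Rightarrow> real"
  assumes X: "\<And>i. i \<in> F \<Longrightarrow> distributed M lborel (X i) std_normal_density"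
    and indep: "indep_vars (\<lambda>_. borel) X F"
    and F: "finite F" and a: "\<And>i. i \<in> F \<Longrightarrow> a i \<noteq> 0"
    and "j \<in> F" "\<theta> \<ge> 0"
  shows "prob {w \<in> space M. \<bar>K + (\<Sum>i\<in>F. a i * X i w)\<bar> < \<theta>} \<le> 2 * \<theta> / \<bar>a j\<bar>"
proof -
  define \<sigma> where "\<sigma> = sqrt (\<Sum>i\<in>F. \<bar>a i\<bar>\<^sup>2)"
  have "F \<noteq> {}" using \<open>j \<in> F\<close> by auto
  have ind: "indep_vars (\<lambda>_. borel) (\<lambda>i w. a i * X i w) F"
    using indep by (rule indep_vars_compose2[where Y = "\<lambda>i x. a i * x"]) auto
  have "distributed M lborel (\<lambda>w. a i * X i w) (normal_density 0 \<bar>a i\<bar>)" if "i \<in> F" for i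
    using normal_density_affine[OF X[OF that], of "a i" 0] a[OF that] by simp
  then have "distributed M lborel (\<lambda>w. \<Sum>i\<in>F. a i * X i w) (normal_density (\<Sum>i\<in>F. 0) \<sigma>)"
    unfolding \<sigma>_def using a by (intro sum_indep_normal[OF F \<open>F \<noteq> {}\<close> ind]) auto
  moreover have "\<bar>a j\<bar>\<^sup>2 \<le> (\<Sum>i\<in>F. \<bar>a i\<bar>\<^sup>2)"
    using assms by (intro member_le_sum[where f = "\<lambda>i. \<bar>a i\<bar>\<^sup>2"]) auto
  then have s: "\<bar>a j\<bar> \<le> \<sigma>"
    unfolding \<sigma>_def by (rule real_le_rsqrt)
  moreover have "\<bar>a j\<bar> > 0" using a[OF \<open>j \<in> F\<close>] by simp
  ultimately have "prob {w \<in> space M. \<bar>K + (\<Sum>i\<in>F. a i * X i w)\<bar> < \<theta>} \<le> 2 * \<theta> / \<sigma>"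
    using \<open>\<theta> \<ge> 0\<close> by (intro normal_prob_interval_le[where \<mu> = "\<Sum>i\<in>F. 0"]) auto
  also have "\<dots> \<le> 2 * \<theta> / \<bar>a j\<bar>"
    using s \<open>\<bar>a j\<bar> > 0\<close> \<open>\<theta> \<ge> 0\<close> by (intro divide_left_mono) auto
  finally show ?thesis .
qed

section \<open>Small divisors of the Gaussian part\<close>

lemma japanese_bracket_ge_1: "japanese_bracket x \<ge> 1"
  by (simp add: japanese_bracket_def)

lemma japanese_bracket_nonneg: "japanese_bracket x \<ge> 0"
  using japanese_bracket_ge_1[of x] by linarith

lemma japanese_bracket_powr_2: "japanese_bracket x powr 2 = 1 + x\<^sup>2"
  by (simp add: japanese_bracket_nonneg powr_numeral) (simp add: japanese_bracket_def add_nonneg_nonneg)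

lemma japanese_bracket_powr_le_power:
  assumes "0 \<le> s" "s + 2 \<le> real t"
  shows "(1 + x\<^sup>2) * japanese_bracket x powr s \<le> japanese_bracket x ^ t"
proof -
  let ?j = "japanese_bracket x"
  have "(1 + x\<^sup>2) * ?j powr s = ?j powr (2 + s)"
    by (simp add: powr_add japanese_bracket_powr_2)
  also have "\<dots> \<le> ?j powr real t"
    using japanese_bracket_ge_1[of x] assms by (intro powr_mono) auto
  also have "\<dots> = ?j ^ t"
    using japanese_bracket_ge_1[of x] by (intro powr_realpow) linarith
  finally show ?thesis .
qed

text \<open>
  A tuple of distinct indices \<open>h j\<close> with nonzero integer coefficients \<open>m j\<close> is encoded, up to the order of
  its entries, as the finite set of the pairs \<open>(h j, m j)\<close>; injectivity of \<open>fst\<close> says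
  that the indices are distinct. Such sets are the nonempty finite graphs of partial functions with
  nonzero values.
\<close>

definition index_coeff_family :: "(int \<times> int) set \<Rightarrow> bool" where
  "index_coeff_family G \<longleftrightarrow> finite G \<and> G \<noteq> {} \<and> inj_on fst G \<and> (\<forall>g\<in>G. snd g \<noteq> 0)"

text \<open>
  The part of the lower bound for a small divisor that depends on the indices and the coefficients. Its
  decay in both makes the union bound over all families converge.
\<close>

definition divisor_weight :: "nat \<Rightarrow> (int \<times> int) set \<Rightarrow> real" where
  "divisor_weight t G =
    (\<Prod>g\<in>G. 1 / (japanese_bracket (real_of_int (fst g)) ^ t * (1 + (real_of_int (snd g))\<^sup>2)))"

lemma countable_index_coeff_family: "countable (Collect index_coeff_family)"
  by (rule countable_subset[OF _ countable_Collect_finite]) (auto simp: index_coeff_family_def)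

lemma divisor_weight_nonneg: "divisor_weight t G \<ge> 0"
  unfolding divisor_weight_def
  by (intro prod_nonneg) (simp add: japanese_bracket_nonneg)

text \<open>
  The factor \<open>\<langle>k\<rangle> powr s\<close>, for one index \<open>k\<close> of the family, is the loss in the
  small ball estimate; the spare powers of the brackets in the weight make up for it.
\<close>

lemma divisor_weight_times_bracket_le:
  assumes "index_coeff_family G" "g0 \<in> G" "0 \<le> s" "s + 2 \<le> real t"
  shows "divisor_weight t G * japanese_bracket (real_of_int (fst g0)) powr s \<le>
    (\<Prod>g\<in>G. 1 / (1 + (real_of_int (fst g))\<^sup>2) * (1 / (1 + (real_of_int (snd g))\<^sup>2)))"
proof -
  let ?j = "\<lambda>g::int\<times>int. japanese_bracket (real_of_int (fst g))"
  let ?b = "\<lambda>g::int\<times>int. 1 + (real_of_int (snd g))\<^sup>2"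
  have G: "finite G" using assms by (simp add: index_coeff_family_def)
  have j1: "?j g \<ge> 1" for g by (rule japanese_bracket_ge_1)
  have b0: "?b g > 0" for g by (simp add: add_pos_nonneg)
  have "(\<Prod>g\<in>{g0}. ?j g powr s) \<le> (\<Prod>g\<in>G. ?j g powr s)"
    using G assms j1 by (intro prod_mono2) (auto intro: ge_one_powr_ge_zero)
  then have "divisor_weight t G * ?j g0 powr s \<le> divisor_weight t G * (\<Prod>g\<in>G. ?j g powr s)"
    using divisor_weight_nonneg by (intro mult_left_mono) auto
  also have "\<dots> = (\<Prod>g\<in>G. 1 / (?j g ^ t * ?b g) * ?j g powr s)"
    unfolding divisor_weight_def prod.distrib ..
  also have "\<dots> \<le> (\<Prod>g\<in>G. 1 / (1 + (real_of_int (fst g))\<^sup>2) * (1 / ?b g))"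
  proof (intro prod_mono conjI)
    fix g
    have j: "?j g ^ t > 0" using j1[of g] by auto
    show "0 \<le> 1 / (?j g ^ t * ?b g) * ?j g powr s"
      using j b0[of g] by simp
    have a: "1 + (real_of_int (fst g))\<^sup>2 > 0" by (simp add: add_pos_nonneg)
    have "?j g powr s / ?j g ^ t \<le> 1 / (1 + (real_of_int (fst g))\<^sup>2)"
      using japanese_bracket_powr_le_power[OF assms(3,4), of "fst g"] j a
      by (simp add: divide_le_eq le_divide_eq mult.commute)
    then have "?j g powr s / ?j g ^ t * (1 / ?b g) \<le> 1 / (1 + (real_of_int (fst g))\<^sup>2) * (1 / ?b g)"
      using b0[of g] by (intro mult_right_mono) auto
    then show "1 / (?j g ^ t * ?b g) * ?j g powr s \<le> 1 / (1 + (real_of_int (fst g))\<^sup>2) * (1 / ?b g)"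
      by simp
  qed
  finally show ?thesis .
qed

lemma sum_divisor_bounds_bounded:
  obtains C :: real where "\<And>A. finite A \<Longrightarrow> (\<And>x. x \<in> A \<Longrightarrow> index_coeff_family (snd x)) \<Longrightarrow>
    (\<Sum>(K, G)\<in>A. 1 / (1 + (real_of_int K)\<^sup>2) *
      (\<Prod>g\<in>G. 1 / (1 + (real_of_int (fst g))\<^sup>2) * (1 / (1 + (real_of_int (snd g))\<^sup>2)))) \<le> C"
proof -
  let ?i = "\<lambda>k::int. 1 / (1 + (real_of_int k)\<^sup>2)"
  obtain C where C0: "C \<ge> 0" and C: "\<And>A. finite A \<Longrightarrow> sum ?i A \<le> C"
    using sum_int_inverse_squares_bounded by blast
  define u where "u g = ?i (fst g) * ?i (snd g)" for g
  have u0: "u g \<ge> 0" for g by (simp add: u_def)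
  have s0: "sum ?i A \<ge> 0" for A by (intro sum_nonneg) auto
  have uC: "sum u A \<le> C * C" if "finite A" for A
  proof -
    have "sum u A \<le> sum u (fst ` A \<times> snd ` A)"
      using that u0 by (intro sum_mono2) (auto intro: rev_image_eqI)
    also have "\<dots> = sum ?i (fst ` A) * sum ?i (snd ` A)"
      unfolding sum_product sum.cartesian_product u_def by (simp add: case_prod_unfold)
    also have "\<dots> \<le> C * C"
      using that s0 C0 by (intro mult_mono C) auto
    finally show ?thesis .
  qed
  show ?thesis
  proof
    fix A :: "(int \<times> (int \<times> int) set) set"
    assume A: "finite A" and adm: "\<And>x. x \<in> A \<Longrightarrow> index_coeff_family (snd x)"
    have "(\<Sum>(K, G)\<in>A. ?i K * prod u G) \<le> (\<Sum>(K, G)\<in>fst ` A \<times> snd ` A. ?i K * prod u G)"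
      using A u0 by (intro sum_mono2) (auto intro: rev_image_eqI intro!: prod_nonneg divide_nonneg_nonneg)
    also have "\<dots> = sum ?i (fst ` A) * (\<Sum>G\<in>snd ` A. prod u G)"
      unfolding sum_product sum.cartesian_product by simp
    also have "\<dots> \<le> C * exp (C * C)"
    proof (intro mult_mono C)
      show "(\<Sum>G\<in>snd ` A. prod u G) \<le> exp (C * C)"
        using A adm by (intro sum_prod_finite_sets_le_exp u0 uC) (auto simp: index_coeff_family_def)
    qed (use A C0 u0 in \<open>auto intro!: sum_nonneg prod_nonneg\<close>)
    finally show "(\<Sum>(K, G)\<in>A. ?i K *
      (\<Prod>g\<in>G. ?i (fst g) * ?i (snd g))) \<le> C * exp (C * C)"
      unfolding u_def .
  qed
qed

lemma (in prob_space) AE_small_divisor_bound: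
  fixes X :: "int \<Rightarrow> 'a \<Rightarrow> real"
  assumes X: "\<And>k. distributed M lborel (X k) std_normal_density"
    and indep: "indep_vars (\<lambda>_. borel) X UNIV"
    and s: "0 \<le> s" "s + 2 \<le> real t" and c: "c \<ge> 1"
  shows "AE w in M. \<exists>\<delta>>0. \<forall>K G. index_coeff_family G \<longrightarrow>
    \<delta> * (1 / (1 + (real_of_int K)\<^sup>2) * divisor_weight t G) \<le>
    \<bar>real_of_int K + (\<Sum>g\<in>G. real_of_int (snd g) *
        (c * (X (fst g) w * japanese_bracket (real_of_int (fst g)) powr (- s))))\<bar>"
proof -
  define S where "S K G w = real_of_int K + (\<Sum>g\<in>G. real_of_int (snd g) *
        (c * (X (fst g) w * japanese_bracket (real_of_int (fst g)) powr (- s))))" for K G w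
  define E where "E = (\<lambda>(K, G) \<delta>. {w \<in> space M.
    \<bar>S K G w\<bar> < \<delta> * (1 / (1 + (real_of_int K)\<^sup>2) * divisor_weight t G)})"
  define p where "p = (\<lambda>(K, G). 1 / (1 + (real_of_int K)\<^sup>2) *
      (\<Prod>g\<in>G. 1 / (1 + (real_of_int (fst g))\<^sup>2) * (1 / (1 + (real_of_int (snd g))\<^sup>2))))"
  \<comment> \<open>\<open>2 * p\<close> bounds the probabilities of the events \<open>E\<close>, up to the factor \<open>\<delta>\<close>.\<close>
  obtain C where C: "\<And>A. finite A \<Longrightarrow> (\<And>x. x \<in> A \<Longrightarrow> index_coeff_family (snd x)) \<Longrightarrow> sum p A \<le> C"
    using sum_divisor_bounds_bounded unfolding p_def by blast
  have [measurable]: "X k \<in> borel_measurable M" for k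
    using distributed_measurable[OF X] by simp
  have [measurable]: "S K G \<in> borel_measurable M" for K G
    unfolding S_def by measurable
  let ?T = "(UNIV :: int set) \<times> Collect index_coeff_family"
  have "AE w in M. \<exists>\<delta>. 0 < \<delta> \<and> \<delta> \<le> 1 \<and> (\<forall>i\<in>?T. w \<notin> E i \<delta>)"
  proof (rule AE_ex_avoid_shrinking_events)
    show "countable ?T" by (rule countable_SIGMA[OF countableI_type countable_index_coeff_family])
    show "E i \<delta> \<in> events" for i \<delta>
      unfolding E_def by (cases i) simp
    show "(\<Sum>x\<in>A. 2 * p x) \<le> 2 * C" if "finite A" "A \<subseteq> ?T" for A
    proof -
      have "sum p A \<le> C" using that by (intro C) auto
      then show ?thesis unfolding sum_distrib_left[symmetric] by simp
    qed
    fix i and \<delta> :: real assume "i \<in> ?T" and \<delta>: "0 < \<delta>" "\<delta> \<le> 1"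
    then obtain K G where i: "i = (K, G)" and G: "index_coeff_family G" by auto
    obtain g0 where g0: "g0 \<in> G" using G by (auto simp: index_coeff_family_def)
    define \<theta> where "\<theta> = \<delta> * (1 / (1 + (real_of_int K)\<^sup>2) * divisor_weight t G)"
    \<comment> \<open>\<open>n k\<close> is the coefficient that \<open>G\<close> attaches to the index \<open>k\<close>.\<close>
    define n where "n k = snd (the_inv_into G fst k)" for k
    define a where "a k = real_of_int (n k) * c * japanese_bracket (real_of_int k) powr (- s)" for k
    have inj: "inj_on fst G" using G by (simp add: index_coeff_family_def)
    have n: "n (fst g) = snd g" if "g \<in> G" for g
      using that unfolding n_def by (simp add: the_inv_into_f_f[OF inj])
    have j1: "japanese_bracket x \<ge> 1" for x by (rule japanese_bracket_ge_1)
    have j0: "japanese_bracket x powr r > 0" for x r using j1[of x] by auto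
    have Seq: "S K G w = K + (\<Sum>k\<in>fst ` G. a k * X k w)" for w
      unfolding S_def sum.reindex[OF inj] a_def by (auto intro!: sum.cong simp: n)
    have \<theta>0: "\<theta> \<ge> 0" unfolding \<theta>_def using \<delta> divisor_weight_nonneg[of t G] by simp
    have anz: "a k \<noteq> 0" if "k \<in> fst ` G" for k
    proof -
      from that obtain g where g: "g \<in> G" "k = fst g" by auto
      then have "n k \<noteq> 0" using G by (simp add: n index_coeff_family_def)
      then show ?thesis using c j0[of k "- s"] by (simp add: a_def)
    qed
    have "\<bar>real_of_int (snd g0)\<bar> \<ge> 1" using G g0 unfolding index_coeff_family_def
      by (metis of_int_1_le_iff of_int_abs zero_less_abs_iff zless_imp_add1_zle add_0)
    then have "1 * 1 * japanese_bracket (fst g0) powr (- s) \<le> \<bar>a (fst g0)\<bar>"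
      unfolding a_def n[OF g0] abs_mult using c
      by (intro mult_mono) auto
    then have ag: "japanese_bracket (fst g0) powr (- s) \<le> \<bar>a (fst g0)\<bar>" by simp
    have "prob (E i \<delta>) = prob {w \<in> space M. \<bar>K + (\<Sum>k\<in>fst ` G. a k * X k w)\<bar> < \<theta>}"
      unfolding E_def i by (simp add: Seq \<theta>_def)
    also have "\<dots> \<le> 2 * \<theta> / \<bar>a (fst g0)\<bar>"
      using G g0 \<theta>0 anz
      by (intro prob_gaussian_sum_small X indep_vars_subset[OF indep]) (auto simp: index_coeff_family_def)
    also have "\<dots> \<le> 2 * \<theta> / japanese_bracket (fst g0) powr (- s)"
      using ag \<theta>0 j0[of "fst g0" "- s"] less_le_trans[OF j0 ag]
      by (intro divide_left_mono mult_pos_pos) auto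
    also have "\<dots> = \<delta> * (2 * (1 / (1 + (real_of_int K)\<^sup>2) *
        (divisor_weight t G * japanese_bracket (fst g0) powr s)))"
      by (simp add: \<theta>_def powr_minus divide_simps)
    also have "\<dots> \<le> \<delta> * (2 * p i)"
      unfolding p_def i prod.case using \<delta>
      by (intro mult_left_mono divisor_weight_times_bracket_le[OF G g0 s]) auto
    finally show "prob (E i \<delta>) \<le> \<delta> * (2 * p i)" .
  qed
  with AE_space show ?thesis
  proof eventually_elim
    case (elim w)
    then obtain \<delta> where "\<delta> > 0" and \<delta>: "\<And>i. i \<in> ?T \<Longrightarrow> w \<notin> E i \<delta>" by blast
    have "\<delta> * (1 / (1 + (real_of_int K)\<^sup>2) * divisor_weight t G) \<le> \<bar>S K G w\<bar>"
      if "index_coeff_family G" for K G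
      using \<delta>[of "(K, G)"] that elim(1) by (auto simp: E_def not_less)
    with \<open>\<delta> > 0\<close> show ?case unfolding S_def by blast
  qed
qed

section \<open>Growth of Gaussian sequences\<close>

lemma (in prob_space) AE_gaussian_growth:
  fixes X :: "int \<Rightarrow> 'a \<Rightarrow> real"
  assumes X: "\<And>k. distributed M lborel (X k) std_normal_density" and "\<sigma> > 0"
  shows "AE w in M. \<exists>R. \<forall>k. \<bar>X k w\<bar> \<le> R * japanese_bracket (real_of_int k) powr \<sigma>"
proof -
  \<comment> \<open>Chebyshev's inequality for the moment of order \<open>2 * r\<close> gives tails of size
    \<open>\<langle>k\<rangle> powr (- 2 * r * \<sigma>)\<close>, which are summable once \<open>r * \<sigma> \<ge> 1\<close>.\<close>
  obtain r :: nat where r: "real r \<ge> 1 / \<sigma>" using real_arch_simple by blast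
  then have r0: "r > 0" using \<open>\<sigma> > 0\<close> by (metis divide_pos_pos gr0I leD of_nat_0 zero_less_one)
  define m where "m = (\<integral>x. std_normal_density x * x ^ (2 * r) \<partial>lborel)"
  have m0: "m \<ge> 0" unfolding m_def by (intro integral_nonneg_AE) (auto simp: power_mult)
  have [measurable]: "X k \<in> borel_measurable M" for k
    using distributed_measurable[OF X] by simp
  have int: "integrable M (\<lambda>w. X k w ^ (2 * r))" for k
    by (subst distributed_integrable[OF X, symmetric]) (auto intro: integrable_std_normal_moment)
  have mom: "(\<integral>w. X k w ^ (2 * r) \<partial>M) = m" for k
    unfolding m_def by (subst distributed_integral[OF X, symmetric]) auto
  let ?j = "\<lambda>k. japanese_bracket (real_of_int k)"
  have j1: "?j k \<ge> 1" for k by (rule japanese_bracket_ge_1)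
  define E where "E k \<delta> = {w \<in> space M. \<bar>X k w\<bar> > ?j k powr \<sigma> / \<delta>}" for k and \<delta> :: real
  obtain C where C0: "C \<ge> 0" and C: "\<And>A. finite A \<Longrightarrow> (\<Sum>k\<in>A. 1 / (1 + (real_of_int k)\<^sup>2)) \<le> C"
    using sum_int_inverse_squares_bounded by blast
  have "AE w in M. \<exists>\<delta>. 0 < \<delta> \<and> \<delta> \<le> 1 \<and> (\<forall>k\<in>UNIV. w \<notin> E k \<delta>)"
  proof (rule AE_ex_avoid_shrinking_events)
    show "E k \<delta> \<in> events" for k \<delta>
      unfolding E_def by simp
    show "(\<Sum>k\<in>A. m * (1 / (1 + (real_of_int k)\<^sup>2))) \<le> m * C" if "finite A" for A
      using C[OF that] m0 unfolding sum_distrib_left[symmetric] by (rule mult_left_mono)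
    fix k :: int and \<delta> :: real assume \<delta>: "0 < \<delta>" "\<delta> \<le> 1"
    define y where "y = ?j k powr \<sigma> / \<delta>"
    have y0: "y > 0" using \<delta> j1[of k] by (auto simp: y_def)
    have y1: "(1 + (real_of_int k)\<^sup>2) / \<delta> \<le> y ^ (2 * r)"
    proof -
      have "1 + (real_of_int k)\<^sup>2 = ?j k powr 2"
        by (rule japanese_bracket_powr_2[symmetric])
      also have "\<dots> \<le> ?j k powr (\<sigma> * real (2 * r))"
      proof (rule powr_mono[OF _ j1])
        have "1 \<le> \<sigma> * real r" using r \<open>\<sigma> > 0\<close> by (simp add: divide_le_eq mult.commute)
        then show "2 \<le> \<sigma> * real (2 * r)" by simp
      qed
      also have "\<dots> = (?j k powr \<sigma>) ^ (2 * r)"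
        using j1[of k] by (subst powr_powr[symmetric], subst powr_realpow) auto
      finally have 1: "1 + (real_of_int k)\<^sup>2 \<le> (?j k powr \<sigma>) ^ (2 * r)" .
      have "\<delta> ^ (2 * r) \<le> \<delta> ^ 1"
        using \<delta> r0 by (intro power_decreasing) auto
      then show ?thesis
        unfolding y_def power_divide using 1 \<delta> by (intro frac_le) auto
    qed
    have "prob (E k \<delta>) \<le> prob {w \<in> space M. X k w ^ (2 * r) \<ge> y ^ (2 * r)}"
    proof (rule finite_measure_mono)
      show "E k \<delta> \<subseteq> {w \<in> space M. X k w ^ (2 * r) \<ge> y ^ (2 * r)}"
        unfolding E_def y_def[symmetric] using y0 power_mono[of y _ "2 * r"]
        by (auto simp: power_even_abs[symmetric, of "2 * r" "X k _"] simp del: power_even_abs)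
    qed simp
    also have "\<dots> \<le> m / y ^ (2 * r)"
      unfolding mom[of k, symmetric] using y0
      by (intro integral_Markov_inequality_measure[OF int, where A = "{}"]) (auto simp: power_mult)
    also have "\<dots> \<le> m / ((1 + (real_of_int k)\<^sup>2) / \<delta>)"
      using y1 y0 \<delta> m0 by (intro divide_left_mono mult_pos_pos divide_pos_pos add_pos_nonneg) auto
    finally show "prob (E k \<delta>) \<le> \<delta> * (m * (1 / (1 + (real_of_int k)\<^sup>2)))"
      by (simp add: mult.commute)
  qed simp
  with AE_space show ?thesis
  proof eventually_elim
    case (elim w)
    then obtain \<delta> where "\<delta> > 0" and \<delta>: "\<And>k. w \<notin> E k \<delta>" by blast
    have "\<bar>X k w\<bar> \<le> (1 / \<delta>) * ?j k powr \<sigma>" for k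
      using \<delta>[of k] elim(1) by (auto simp: E_def not_less)
    then show ?case by blast
  qed
qed

section \<open>A gap in the sizes of the indices\<close>

text \<open>
  Let \<open>Q S = A * (\<Prod>j\<in>S. b j ^ t)\<close>. Take \<open>S\<close> maximal, for inclusion, among the sets that contain \<open>j0\<close>
  and satisfy \<open>Q S \<le> (Q {j0}) ^ ((1 + r * t) ^ card S)\<close>. If some \<open>j\<close> outside \<open>S\<close> had
  \<open>b j \<le> Q S ^ r\<close>, then \<open>Q (insert j S) \<le> Q S ^ (1 + r * t)\<close>, and \<open>S\<close> would not be maximal.
  Counting the whole product in \<open>Q S\<close>, instead of bounding each of its factors by the largest one, keeps the
  ratio \<open>1 + r * t\<close> of successive exponents independent of \<open>card S\<close>; the final exponent is
  thereby exponential in \<open>card J\<close> rather than factorial.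
\<close>

lemma ex_gap_subset:
  fixes b :: "'i \<Rightarrow> real"
  assumes J: "finite J" "j0 \<in> J" and A: "A \<ge> 1" and b: "\<And>j. b j \<ge> 1"
  obtains S where "j0 \<in> S" "S \<subseteq> J"
    "A * (\<Prod>j\<in>S. b j ^ t) \<le> (A * b j0 ^ t) ^ ((1 + r * t) ^ card J)"
    "\<And>j. j \<in> J - S \<Longrightarrow> (A * (\<Prod>j\<in>S. b j ^ t)) ^ r < b j"
proof -
  define Q where "Q S = A * (\<Prod>j\<in>S. b j ^ t)" for S
  let ?\<kappa> = "1 + r * t"
  let ?q = "A * b j0 ^ t"
  define \<S> where "\<S> = {S. j0 \<in> S \<and> S \<subseteq> J \<and> Q S \<le> ?q ^ (?\<kappa> ^ card S)}"
  have ge1: "x * y \<ge> 1" if "x \<ge> 1" "y \<ge> 1" for x y :: real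
    using mult_mono[OF that] that by simp
  have q1: "?q \<ge> 1" using A b by (intro ge1 one_le_power) auto
  have Q1: "Q S \<ge> 1" for S
    unfolding Q_def using A b by (intro ge1 prod_ge_1 one_le_power) auto
  have "{j0} \<in> \<S>"
    using J power_increasing[OF _ q1, of 1 ?\<kappa>] by (simp add: \<S>_def Q_def)
  moreover have "finite \<S>"
    using J by (auto simp: \<S>_def intro: finite_subset[of _ "Pow J"])
  ultimately obtain S where S: "S \<in> \<S>" and max: "\<And>S'. S' \<in> \<S> \<Longrightarrow> S \<subseteq> S' \<Longrightarrow> S' = S"
    by (metis empty_iff finite_has_maximal)
  have "finite S" using S J by (auto simp: \<S>_def intro: finite_subset)
  have gap: "Q S ^ r < b j" if j: "j \<in> J - S" for j
  proof (rule ccontr)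
    assume "\<not> Q S ^ r < b j"
    then have "b j ^ t \<le> (Q S ^ r) ^ t"
      using b[of j] by (intro power_mono) auto
    then have "Q S * b j ^ t \<le> Q S * (Q S ^ r) ^ t"
      using Q1[of S] by (intro mult_left_mono) auto
    also have "\<dots> = Q S ^ ?\<kappa>" by (simp add: power_mult[symmetric])
    also have "\<dots> \<le> (?q ^ (?\<kappa> ^ card S)) ^ ?\<kappa>"
      using S Q1[of S] by (intro power_mono) (auto simp: \<S>_def)
    also have "\<dots> = ?q ^ (?\<kappa> ^ card (insert j S))"
      using j \<open>finite S\<close> by (simp only: power_mult[symmetric]) (simp add: mult.commute)
    finally have "Q (insert j S) \<le> ?q ^ (?\<kappa> ^ card (insert j S))"
      using j \<open>finite S\<close> by (simp add: Q_def mult_ac)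
    then have "insert j S \<in> \<S>" using S j by (simp add: \<S>_def)
    then show False using max[of "insert j S"] j by auto
  qed
  have "card S \<le> card J" using S J by (intro card_mono) (auto simp: \<S>_def)
  then have "?q ^ (?\<kappa> ^ card S) \<le> ?q ^ (?\<kappa> ^ card J)"
    by (intro power_increasing q1) auto
  then show ?thesis
    using S gap by (intro that[of S]) (auto simp: \<S>_def Q_def intro: order_trans)
qed

section \<open>From small divisor bounds to strong non-resonance\<close>

lemma strongly_non_resonant_quadratic_plus:
  fixes V :: "int \<Rightarrow> real"
  assumes \<sigma>: "\<sigma> > 0"
    and decay: "\<And>k. \<bar>V k\<bar> \<le> R * japanese_bracket (real_of_int k) powr (- \<sigma>)"
    and \<delta>: "\<delta> > 0"
    and small: "\<And>K G. index_coeff_family G \<Longrightarrow>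
      \<delta> * (1 / (1 + (real_of_int K)\<^sup>2) * divisor_weight t G) \<le>
      \<bar>real_of_int K + (\<Sum>g\<in>G. real_of_int (snd g) * V (fst g))\<bar>"
  shows "strongly_non_resonant UNIV (\<lambda>k. (real_of_int k)\<^sup>2 + V k)"
proof -
  have R: "R \<ge> 0" using order_trans[OF abs_ge_zero decay[of 0]] by (simp add: japanese_bracket_def)
  \<comment> \<open>A bracket above \<open>Q ^ r\<close> makes the corresponding \<open>\<bar>V k\<bar>\<close> at most \<open>R / Q\<close>.\<close>
  obtain r :: nat where r: "real r \<ge> 1 / \<sigma>" using real_arch_simple by blast
  then have r\<sigma>: "1 \<le> real r * \<sigma>" using \<sigma> by (simp add: divide_le_eq)
  obtain d :: nat where d: "max (R + 2) (1 / \<delta>) < 2 ^ d"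
    using real_arch_pow[of 2 "max (R + 2) (1 / \<delta>)"] by auto
  \<comment> \<open>\<open>\<alpha>\<close> is chosen so that \<open>e * M * \<kappa> ^ q \<le> exp (\<alpha> * M)\<close> whenever \<open>1 \<le> q \<le> M\<close>,
    where \<open>M\<close> is the sum of the \<open>\<bar>m j\<bar>\<close>.\<close>
  define \<kappa> where "\<kappa> = 1 + r * t"
  define e where "e = 4 * d + 5 + t"
  define \<alpha> where "\<alpha> = ln (real (2 * e * \<kappa>))"
  have ek: "2 * e * \<kappa> \<ge> 2" using mult_mono[of 2 "2 * e" 1 \<kappa>] by (simp add: e_def \<kappa>_def)
  have \<alpha>: "\<alpha> > 0" unfolding \<alpha>_def using ek by (subst ln_gt_zero_iff) linarith+
  have main: "(2 * Min ((\<lambda>j. japanese_bracket (real_of_int (h j))) ` {1..q}))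
              powr (- exp (\<alpha> * real_of_int (\<Sum>j=1..q. \<bar>m j\<bar>))) \<le>
     \<bar>\<Sum>j=1..q. real_of_int (m j) * ((real_of_int (h j))\<^sup>2 + V (h j))\<bar>"
    if q: "q \<ge> 1" and m: "\<forall>j\<in>{1..q}. m j \<noteq> 0" and inj: "inj_on h {1..q}"
    for q :: nat and m h :: "nat \<Rightarrow> int"
  proof -
    define J where "J = {1..q}"
    define b where "b j = japanese_bracket (real_of_int (h j))" for j
    define M where "M = (\<Sum>j\<in>J. nat \<bar>m j\<bar>)"
    have b1: "b j \<ge> 1" for j unfolding b_def by (rule japanese_bracket_ge_1)
    have J: "finite J" "J \<noteq> {}" "card J = q" using q by (auto simp: J_def)
    have "(\<Sum>j\<in>J. 1) \<le> M"
      unfolding M_def using m by (intro sum_mono) (auto simp: J_def Suc_le_eq)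
    then have M: "q \<le> M" "M \<ge> 1" using J q by auto
    have MS: "(\<Sum>j\<in>S. \<bar>real_of_int (m j)\<bar>) = real (\<Sum>j\<in>S. nat \<bar>m j\<bar>)" for S
      by simp
    have M_le: "(\<Sum>j\<in>S. nat \<bar>m j\<bar>) \<le> M" if "S \<subseteq> J" for S
      unfolding M_def using that J by (intro sum_mono2) auto
    have "Min (b ` J) \<in> b ` J" using J by (intro Min_in) auto
    then obtain j0 where j0: "j0 \<in> J" "Min (b ` J) = b j0" by auto
    \<comment> \<open>\<open>A = L * 2 ^ (M + d)\<close>, where \<open>1 / L\<close> is the constant in the lower bound for the part over \<open>S\<close>
      and \<open>2 ^ (M + d)\<close> dominates \<open>1 + M * R\<close>; the part outside \<open>S\<close> is at most \<open>M * R / Q\<close>.\<close>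
    define A :: real where "A = 2 ^ (4 * d + 5 * M)"
    have A1: "A \<ge> 1" unfolding A_def by simp
    obtain S where S: "j0 \<in> S" "S \<subseteq> J"
      and SQ: "A * (\<Prod>j\<in>S. b j ^ t) \<le> (A * b j0 ^ t) ^ (\<kappa> ^ card J)"
      and gap: "\<And>j. j \<in> J - S \<Longrightarrow> (A * (\<Prod>j\<in>S. b j ^ t)) ^ r < b j"
      by (rule ex_gap_subset[where b = b and t = t and r = r, OF J(1) j0(1) A1 b1, folded \<kappa>_def]) (rule that, assumption+)
    have finS: "finite S" using S J finite_subset by blast
    define P where "P = (\<Prod>j\<in>S. b j ^ t)"
    define Q where "Q = A * P"
    have P1: "P \<ge> 1" unfolding P_def using b1 by (intro prod_ge_1 one_le_power) auto
    have Q1: "Q \<ge> 1" unfolding Q_def using mult_mono[OF A1 P1] A1 by simp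
    define K where "K = (\<Sum>j\<in>J. m j * (h j)\<^sup>2)"
    have total: "(\<Sum>j=1..q. real_of_int (m j) * ((real_of_int (h j))\<^sup>2 + V (h j))) =
        real_of_int K + (\<Sum>j\<in>J. real_of_int (m j) * V (h j))"
      unfolding K_def J_def by (simp add: distrib_left sum.distrib)
    have lin: "\<bar>\<Sum>j\<in>B. real_of_int (m j) * V (h j)\<bar> \<le> M * (R * y)"
      if "B \<subseteq> J" "y \<ge> 0" "\<And>j. j \<in> B \<Longrightarrow> b j powr (- \<sigma>) \<le> y" for B y
    proof -
      have "\<bar>\<Sum>j\<in>B. real_of_int (m j) * V (h j)\<bar> \<le> (\<Sum>j\<in>B. \<bar>real_of_int (m j) * V (h j)\<bar>)"
        by (rule sum_abs)
      also have "\<dots> \<le> (\<Sum>j\<in>B. \<bar>real_of_int (m j)\<bar> * (R * y))"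
        unfolding abs_mult using that R
        by (intro sum_mono mult_left_mono order_trans[OF decay]) (auto simp: b_def)
      also have "\<dots> = real (\<Sum>j\<in>B. nat \<bar>m j\<bar>) * (R * y)"
        unfolding MS[symmetric] sum_distrib_right ..
      also have "\<dots> \<le> M * (R * y)"
        using of_nat_mono[OF M_le[OF that(1)], where 'a = real] R that(2)
        by (intro mult_right_mono mult_nonneg_nonneg)
      finally show ?thesis .
    qed
    have M2: "real M \<le> 2 ^ M" using of_nat_less_two_power[of M, where 'a = real] by simp
    have MR: "real M * R + 2 \<le> 2 ^ (M + d)"
    proof -
      have "real M * R + 2 \<le> real M * (R + 2)" using M by (simp add: distrib_left)
      also have "\<dots> \<le> 2 ^ M * 2 ^ d" using M2 d R by (intro mult_mono) auto
      finally show ?thesis by (simp add: power_add)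
    qed
    have lower: "1 / Q \<le> \<bar>real_of_int K + (\<Sum>j\<in>J. real_of_int (m j) * V (h j))\<bar>"
    proof (cases "\<bar>real_of_int K\<bar> \<ge> real M * R + 1")
      case True
      \<comment> \<open>Here the integer \<open>K\<close> exceeds the whole contribution of \<open>V\<close> by at least \<open>1\<close>.\<close>
      have "\<bar>\<Sum>j\<in>J. real_of_int (m j) * V (h j)\<bar> \<le> M * (R * 1)"
        using b1 \<sigma> powr_mono[of "- \<sigma>" 0] by (intro lin) auto
      moreover have "1 / Q \<le> 1" using Q1 by simp
      ultimately show ?thesis using True by linarith
    next
      case False
      define L :: real where "L = 2 ^ (3 * d + 4 * M)"
      have L0: "L > 0" by (simp add: L_def)
      have AL: "A = L * 2 ^ (M + d)"
        unfolding A_def L_def power_add[symmetric] by (simp add: algebra_simps)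
      define G where "G = (\<lambda>j. (h j, m j)) ` S"
      have injS: "inj_on h S" using inj S by (auto simp: J_def intro: inj_on_subset)
      then have injG: "inj_on (\<lambda>j. (h j, m j)) S" by (auto simp: inj_on_def)
      have adm: "index_coeff_family G"
        using injS S m finS unfolding index_coeff_family_def G_def J_def by (auto simp: inj_on_def)
      have dw: "divisor_weight t G = 1 / (P * (\<Prod>j\<in>S. 1 + (real_of_int (m j))\<^sup>2))"
        unfolding divisor_weight_def G_def prod.reindex[OF injG]
        by (simp add: P_def b_def prod_dividef prod.distrib)
      have p4: "(\<Prod>j\<in>S. 1 + (real_of_int (m j))\<^sup>2) \<le> 4 ^ M"
      proof -
        have "1 + (real_of_int x)\<^sup>2 \<le> 4 ^ nat \<bar>x\<bar>" for x
        proof -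
          have "1 + (real_of_int x)\<^sup>2 \<le> (1 + \<bar>real_of_int x\<bar>)\<^sup>2" by (simp add: power2_sum)
          also have "\<dots> = (1 + real (nat \<bar>x\<bar>))\<^sup>2" by simp
          also have "\<dots> \<le> (2 ^ nat \<bar>x\<bar>)\<^sup>2"
            using Bernoulli_inequality[of 1 "nat \<bar>x\<bar>"] by (intro power_mono) auto
          also have "\<dots> = 4 ^ nat \<bar>x\<bar>" by (simp add: power_mult[symmetric] mult.commute[of _ 2]) (simp add: power_mult)
          finally show ?thesis .
        qed
        then have "(\<Prod>j\<in>S. 1 + (real_of_int (m j))\<^sup>2) \<le> (\<Prod>j\<in>S. 4 ^ nat \<bar>m j\<bar>)"
          by (intro prod_mono) (auto intro: add_nonneg_nonneg)
        also have "\<dots> = 4 ^ (\<Sum>j\<in>S. nat \<bar>m j\<bar>)" by (simp add: power_sum)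
        also have "\<dots> \<le> 4 ^ M" using M_le[OF S(2)] by (intro power_increasing) auto
        finally show ?thesis .
      qed
      have K2: "1 + (real_of_int K)\<^sup>2 \<le> (2 ^ (M + d))\<^sup>2"
      proof -
        have "1 + (real_of_int K)\<^sup>2 \<le> (1 + \<bar>real_of_int K\<bar>)\<^sup>2" by (simp add: power2_sum)
        also have "\<dots> \<le> (2 ^ (M + d))\<^sup>2"
          using False MR by (intro power_mono) auto
        finally show ?thesis .
      qed
      have prod_pos: "(\<Prod>j\<in>S. 1 + (real_of_int (m j))\<^sup>2) > 0"
        by (intro prod_pos) (auto intro: add_pos_nonneg)
      have K0: "1 + (real_of_int K)\<^sup>2 > 0" by (simp add: add_pos_nonneg)
      have L_eq: "L = 2 ^ d * ((2 ^ (M + d))\<^sup>2 * 4 ^ M)"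
      proof -
        have "(4::real) ^ M = 2 ^ (2 * M)" by (simp add: power_mult)
        then show ?thesis unfolding L_def power_mult[symmetric] 
          by (simp only: power_add[symmetric]) (simp add: algebra_simps)
      qed
      have "1 / (L * P) = (1 / 2 ^ d) * (1 / (2 ^ (M + d))\<^sup>2 * (1 / (P * 4 ^ M)))"
        by (simp add: L_eq)
      also have "\<dots> \<le> \<delta> * (1 / (1 + (real_of_int K)\<^sup>2) * divisor_weight t G)"
        unfolding dw
      proof (intro mult_mono)
        show "1 / 2 ^ d \<le> \<delta>" using d \<delta> by (simp add: divide_le_eq divide_less_eq mult.commute)
        show "1 / (2 ^ (M + d))\<^sup>2 \<le> 1 / (1 + (real_of_int K)\<^sup>2)"
          using K2 K0 by (intro frac_le) auto
        show "1 / (P * 4 ^ M) \<le> 1 / (P * (\<Prod>j\<in>S. 1 + (real_of_int (m j))\<^sup>2))"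
          using p4 prod_pos P1 by (intro frac_le mult_left_mono mult_pos_pos) auto
      qed (use \<delta> K0 P1 in auto)
      also have "\<dots> \<le> \<bar>real_of_int K + (\<Sum>g\<in>G. real_of_int (snd g) * V (fst g))\<bar>"
        by (rule small[OF adm])
      also have "(\<Sum>g\<in>G. real_of_int (snd g) * V (fst g)) = (\<Sum>j\<in>S. real_of_int (m j) * V (h j))"
        unfolding G_def sum.reindex[OF injG] by simp
      finally have head: "1 / (L * P) \<le> \<bar>real_of_int K + (\<Sum>j\<in>S. real_of_int (m j) * V (h j))\<bar>" .
      have tail: "\<bar>\<Sum>j\<in>J - S. real_of_int (m j) * V (h j)\<bar> \<le> M * (R * (1 / Q))"
      proof (rule lin)
        fix j assume "j \<in> J - S"
        then have "Q ^ r < b j" using gap by (simp add: Q_def P_def)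
        then have "b j powr (- \<sigma>) \<le> (Q ^ r) powr (- \<sigma>)"
          using Q1 \<sigma> by (intro powr_mono2') auto
        also have "\<dots> = Q powr (- (real r * \<sigma>))"
          using Q1 by (simp add: powr_realpow[symmetric] powr_powr)
        also have "\<dots> \<le> Q powr (- 1)" using r\<sigma> Q1 by (intro powr_mono) auto
        also have "\<dots> = 1 / Q" using Q1 by (simp add: powr_minus_divide)
        finally show "b j powr (- \<sigma>) \<le> 1 / Q" .
      qed (use Q1 in auto)
      have split: "(\<Sum>j\<in>J. real_of_int (m j) * V (h j)) =
          (\<Sum>j\<in>S. real_of_int (m j) * V (h j)) + (\<Sum>j\<in>J - S. real_of_int (m j) * V (h j))"
        using sum.subset_diff[OF S(2) J(1)] by (simp add: add.commute)
      have "1 / Q + M * (R * (1 / Q)) = (1 + M * R) / Q"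
        by (simp add: add_divide_distrib)
      also have "\<dots> \<le> 2 ^ (M + d) / Q"
        using MR Q1 by (intro divide_right_mono) auto
      also have "\<dots> = 1 / (L * P)"
        unfolding Q_def AL using L0 by simp
      finally have "1 / Q + M * (R * (1 / Q)) \<le> 1 / (L * P)" .
      then show ?thesis
        unfolding split using head tail by linarith
    qed
    define H where "H = 2 * b j0"
    have H2: "H \<ge> 2" using b1[of j0] by (simp add: H_def)
    have "A * b j0 ^ t \<le> H ^ (4 * d + 5 * M) * H ^ t"
      unfolding A_def using H2 b1[of j0] by (intro mult_mono power_mono) (auto simp: H_def)
    also have "\<dots> \<le> H ^ (e * M)"
      unfolding power_add[symmetric] using H2 mult_le_mono2[OF M(2), of "4 * d + t"]
      by (intro power_increasing) (auto simp: e_def algebra_simps)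
    finally have "(A * b j0 ^ t) ^ (\<kappa> ^ card J) \<le> (H ^ (e * M)) ^ (\<kappa> ^ card J)"
      using A1 b1[of j0] by (intro power_mono) auto
    then have QH: "Q \<le> H ^ (e * M * \<kappa> ^ q)"
      using SQ unfolding Q_def P_def by (simp add: J(3) power_mult[symmetric])
    have "e * M * \<kappa> ^ q \<le> e ^ M * 2 ^ M * \<kappa> ^ M"
      using M by (intro mult_mono power_increasing self_le_power) (auto simp: e_def \<kappa>_def less_imp_le[OF less_exp])
    also have "\<dots> = (2 * e * \<kappa>) ^ M" by (simp add: power_mult_distrib)
    finally have "real (e * M * \<kappa> ^ q) \<le> real (2 * e * \<kappa>) ^ M"
      by (metis of_nat_le_iff of_nat_power)
    also have "\<dots> = exp (\<alpha> * real M)"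
      using ek unfolding \<alpha>_def by (simp add: exp_of_nat2_mult)
    finally have ex: "real (e * M * \<kappa> ^ q) \<le> exp (\<alpha> * real M)" .
    have "H powr (- exp (\<alpha> * real M)) \<le> H powr (- real (e * M * \<kappa> ^ q))"
      using ex H2 by (intro powr_mono) auto
    also have "\<dots> = 1 / H ^ (e * M * \<kappa> ^ q)"
      using H2 by (simp only: powr_minus_divide) (subst powr_realpow, auto)
    also have "\<dots> \<le> 1 / Q" using QH Q1 by (intro frac_le) auto
    also note lower
    finally have "H powr (- exp (\<alpha> * real M)) \<le>
      \<bar>real_of_int K + (\<Sum>j\<in>J. real_of_int (m j) * V (h j))\<bar>" .
    moreover have "H = 2 * Min ((\<lambda>j. japanese_bracket (real_of_int (h j))) ` {1..q})"
      using j0(2) by (simp add: H_def b_def[abs_def] J_def)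
    moreover have "real M = real_of_int (\<Sum>j=1..q. \<bar>m j\<bar>)"
      using MS[of J] by (simp add: M_def J_def)
    ultimately show ?thesis unfolding total by simp
  qed
  show ?thesis
    unfolding strongly_non_resonant_def
    by (intro exI[of _ \<alpha>] exI[of _ "1::real"] conjI \<alpha>) (use main in auto)
qed

section \<open>Strong non-resonance of the random frequencies\<close>

theorem proposition1p4:
  fixes M :: "'w measure" and X :: "int \<Rightarrow> 'w \<Rightarrow> real" and s :: real
  assumes "prob_space M"
    and "s > 0"
    and "\<And>k. distributed M lborel (X k) std_normal_density"
    and "prob_space.indep_vars M (\<lambda>_. borel) X UNIV"
  shows "AE w in M. strongly_non_resonant UNIV
    (\<lambda>k. (real_of_int k)\<^sup>2 +
      (2 * pi) powr (1/2) * Re (fourier_coeff (random_potential s X w) k))"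
proof -
  interpret prob_space M by fact
  define c where "c = (2 * pi) powr (1/2)"
  have c: "c \<ge> 1"
    unfolding c_def using pi_ge_two by (intro ge_one_powr_ge_zero) auto
  obtain t :: nat where t: "s + 2 \<le> real t" using real_arch_simple by blast
  have "AE w in M. \<exists>R. \<forall>k. \<bar>X k w\<bar> \<le> R * japanese_bracket (real_of_int k) powr (s / 2)"
    using assms by (intro AE_gaussian_growth) auto
  moreover have "AE w in M. \<exists>\<delta>>0. \<forall>K G. index_coeff_family G \<longrightarrow>
    \<delta> * (1 / (1 + (real_of_int K)\<^sup>2) * divisor_weight t G) \<le>
    \<bar>real_of_int K + (\<Sum>g\<in>G. real_of_int (snd g) *
        (c * (X (fst g) w * japanese_bracket (real_of_int (fst g)) powr (- s))))\<bar>"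
    using assms t c by (intro AE_small_divisor_bound) auto
  ultimately show ?thesis
  proof eventually_elim
    case (elim w)
    then obtain R \<delta> where R: "\<And>k. \<bar>X k w\<bar> \<le> R * japanese_bracket (real_of_int k) powr (s / 2)"
      and \<delta>: "\<delta> > 0" and small: "\<And>K G. index_coeff_family G \<Longrightarrow>
        \<delta> * (1 / (1 + (real_of_int K)\<^sup>2) * divisor_weight t G) \<le>
        \<bar>real_of_int K + (\<Sum>g\<in>G. real_of_int (snd g) *
          (c * (X (fst g) w * japanese_bracket (real_of_int (fst g)) powr (- s))))\<bar>"
      by blast
    \<comment> \<open>Half of the decay of the coefficients compensates the growth of the Gaussian variables.\<close>
    have decay: "\<bar>c * (X k w * japanese_bracket (real_of_int k) powr (- s))\<bar> \<le>
        c * R * japanese_bracket (real_of_int k) powr (- (s / 2))" for k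
    proof -
      let ?j = "japanese_bracket (real_of_int k)"
      have "\<bar>c * (X k w * ?j powr (- s))\<bar> = c * (\<bar>X k w\<bar> * ?j powr (- s))"
        using c by (simp add: abs_mult)
      also have "\<dots> \<le> c * (R * ?j powr (s / 2) * ?j powr (- s))"
        using c R by (intro mult_left_mono mult_right_mono) auto
      also have "\<dots> = c * R * ?j powr (- (s / 2))"
        by (simp add: mult.assoc powr_add[symmetric])
      finally show ?thesis .
    qed
    have "strongly_non_resonant UNIV
        (\<lambda>k. (real_of_int k)\<^sup>2 + c * (X k w * japanese_bracket (real_of_int k) powr (- s)))"
      using \<open>s > 0\<close> by (intro strongly_non_resonant_quadratic_plus[OF _ decay \<delta> small]) auto
    then show ?case
      unfolding fourier_coeff_random_potential c_def by simp
  qed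
qed

end
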